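(* Let $d$ be a positive integer and $\varepsilon>0$, and set $n=n^{\mathrm{diam}}(d,\varepsilon)$. Let $\mathcal{F}$ be a finite family of convex sets in $\mathbb{R}^d$ such that for any subfamily $\mathcal{F}'\subset\mathcal{F}$ of at most $nd$ sets, $\operatorname{diam}\left(\bigcap\mathcal{F}'\right)\ge1$. Then $$\operatorname{diam}\left(\bigcap\mathcal{F}\right)\ge(1+\varepsilon)^{-1}.$$ Moreover, if the condition is only required for subfamilies of size at most $n-1$, the conclusion may fail: there exists a finite family $\mathcal{F}$ of convex sets in $\mathbb{R}^d$ such that $\operatorname{diam}\left(\bigcap\mathcal{F}'\right)\ge1$ for every subfamily $\mathcal{F}'\subset\mathcal{F}$ of at most $n-1$ sets, but $\operatorname{diam}\left(\bigcap\mathcal{F}\right)<(1+\varepsilon)^{-1}$.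
   Context: For a positive integer $d$ and $\varepsilon>0$, $n^{\mathrm{diam}}(d,\varepsilon)$ denotes the smallest integer $n$ such that, for any bounded convex set $K\subset\mathbb{R}^d$ with positive volume, there is a polytope $P\supset K$ with at most $n$ facets such that $\operatorname{diam}(P)\le(1+\varepsilon)\operatorname{diam}(K)$. A polytope is the convex hull of finitely many points; $\operatorname{diam}$ is the Euclidean diameter (possibly $+\infty$). The intersection of the empty subfamily is $\mathbb{R}^d$. *)

theory Defs
  imports "HOL-Analysis.Analysis"
begin

text \<open>
  The library's \<^const>\<open>diameter\<close> is real-valued and unspecified on unbounded sets.  The extended
  diameter takes the value \<open>\<infinity>\<close> there (and \<open>0\<close> on the empty set), and agrees with
  \<^const>\<open>diameter\<close> on bounded sets.
\<close>

definition ediam :: "'a::metric_space set \<Rightarrow> ennreal" where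
  "ediam S = (SUP (x, y) \<in> S \<times> S. ennreal (dist x y))"

lemma ediam_bounded:
  assumes "bounded S"
  shows "ediam S = ennreal (diameter S)"
proof (rule antisym)
  show "ediam S \<le> ennreal (diameter S)"
    unfolding ediam_def
    using diameter_bounded_bound[OF assms] by (auto intro!: SUP_least ennreal_leI)
next
  show "ennreal (diameter S) \<le> ediam S"
  proof (cases "ediam S")
    case (real r)
    have "dist x y \<le> r" if "x \<in> S" "y \<in> S" for x y
    proof -
      have "ennreal (dist x y) \<le> ediam S"
        unfolding ediam_def using that by (intro SUP_upper2[where i = "(x, y)"]) auto
      then show ?thesis using real by simp
    qed
    then have "diameter S \<le> r"
      unfolding diameter_def using real(1) by (auto intro!: cSUP_least)
    then show ?thesis using real by (simp add: ennreal_leI)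
  qed simp
qed

lemma ediam_unbounded:
  assumes "\<not> bounded S"
  shows "ediam S = \<infinity>"
proof (cases "ediam S")
  case (real r)
  have "dist x y \<le> r" if "x \<in> S" "y \<in> S" for x y
  proof -
    have "ennreal (dist x y) \<le> ediam S"
      unfolding ediam_def using that by (intro SUP_upper2[where i = "(x, y)"]) auto
    then show ?thesis using real by simp
  qed
  then have "bounded S"
    unfolding bounded_two_points by blast
  with assms show ?thesis by contradiction
qed simp

text \<open>
  The dimension \<open>d\<close> enters through the index type, \<open>d = CARD('n)\<close>.  A polytope containing a set of
  positive volume is full-dimensional, so its facets are its faces of dimension \<open>d - 1\<close>
  (for \<open>d = 1\<close>, the two endpoints of an interval).
\<close>

definition n_diam :: "'n::finite itself \<Rightarrow> real \<Rightarrow> nat" where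
  "n_diam TYPE('n) \<epsilon> =
     (LEAST n. \<forall>K :: (real ^ 'n) set. bounded K \<and> convex K \<and> 0 < emeasure lebesgue K \<longrightarrow>
        (\<exists>P. polytope P \<and> K \<subseteq> P \<and> card {F. F facet_of P} \<le> n
             \<and> ediam P \<le> ennreal (1 + \<epsilon>) * ediam K))"

end

theory Submission
  imports Defs
begin

text \<open>
  Let \<open>h\<close> be a facet halfspace of a polytope \<open>P\<close> containing \<open>\<Inter>\<F>\<close>.  Helly's theorem applied to \<open>\<F>\<close>
  together with the complement of \<open>h\<close> yields at most \<open>d\<close> members of \<open>\<F>\<close> whose intersection already
  lies in \<open>h\<close>, so \<open>n d\<close> members suffice to force the intersection into \<open>P\<close>.  Choosing \<open>P\<close> for a slightly
  thickened \<open>\<Inter>\<F>\<close> gives the first claim.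

  For the second, take a body \<open>K\<close> that no polytope with \<open>n - 1\<close> facets approximates.  By compactness of
  the sphere, the diameters of the intersections of \<open>n - 1\<close> supporting halfspaces of \<open>K\<close> exceed
  \<open>(1 + \<epsilon>) diam K\<close> by a uniform gap.  The supporting halfspaces of \<open>K\<close> in the directions of a
  sufficiently fine net, rescaled, then form the required family.  Such nets also bound the number
  of facets needed uniformly in \<open>K\<close>, so that the minimum defining \<open>n\<close> exists.
\<close>

section \<open>Bounds for the extended diameter\<close>

lemma ediam_le_iff:
  assumes "0 \<le> c"
  shows "ediam S \<le> ennreal c \<longleftrightarrow> (\<forall>x\<in>S. \<forall>y\<in>S. dist x y \<le> c)"
  using assms by (auto simp: ediam_def SUP_le_iff)

lemma ediam_mono:
  assumes "S \<subseteq> T"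
  shows "ediam S \<le> ediam T"
  unfolding ediam_def using assms by (intro SUP_subset_mono) auto

lemma ediam_ge:
  assumes "x \<in> S" "y \<in> S" "c \<le> dist x y"
  shows "ennreal c \<le> ediam S"
  unfolding ediam_def
  using assms by (intro SUP_upper2[where i = "(x, y)"]) (auto intro: ennreal_leI)

section \<open>Supporting halfspaces and nets on the sphere\<close>

lemma bdd_above_inner_image:
  fixes K :: "'a::real_inner set"
  assumes "bounded K"
  shows "bdd_above ((\<bullet>) v ` K)"
  by (intro bounded_imp_bdd_above bounded_linear_image assms bounded_linear_inner_right)

text \<open>The supremum is the support function of \<open>K\<close>, so the halfspaces are the
  supporting ones with outer normals in \<open>N\<close>. Real suprema have this meaning only for
  bounded nonempty \<open>K\<close>.\<close>

definition circumscribed :: "'a::real_inner set \<Rightarrow> 'a set \<Rightarrow> 'a set" where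
  "circumscribed K N = {x. \<forall>v\<in>N. v \<bullet> x \<le> (SUP y\<in>K. v \<bullet> y)}"

lemma subset_circumscribed:
  assumes "bounded K"
  shows "K \<subseteq> circumscribed K N"
  unfolding circumscribed_def
  by (auto intro!: cSUP_upper bdd_above_inner_image[OF assms])

lemma inner_interior_less_SUP:
  fixes K :: "'a::real_inner set"
  assumes "bounded K" "z \<in> interior K" "v \<noteq> 0"
  shows "v \<bullet> z < (SUP y\<in>K. v \<bullet> y)"
proof -
  obtain e where e: "e > 0" "cball z e \<subseteq> K"
    using assms(2) by (auto simp: mem_interior_cball)
  define w where "w = z + (e / norm v) *\<^sub>R v"
  have "w \<in> K"
    using e assms(3) by (intro subsetD[OF e(2)]) (simp add: w_def dist_norm)
  have "v \<bullet> z < v \<bullet> w"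
    using e assms(3) by (simp add: w_def inner_add_right)
  also have "\<dots> \<le> (SUP y\<in>K. v \<bullet> y)"
    by (rule cSUP_upper[OF \<open>w \<in> K\<close> bdd_above_inner_image[OF assms(1)]])
  finally show ?thesis .
qed

text \<open>Closure under negation makes supporting halfspaces come in opposite pairs, so that each
  net direction confines the circumscribed set to a slab.\<close>

lemma symmetric_sphere_net:
  assumes "\<delta> > 0"
  obtains N :: "'a::euclidean_space set" where
    "finite N" "N \<subseteq> sphere 0 1" "\<And>v. v \<in> N \<Longrightarrow> - v \<in> N"
    "\<And>u. norm u = 1 \<Longrightarrow> \<exists>v\<in>N. dist v u < \<delta>"
proof -
  obtain M :: "'a set" where M: "finite M" "M \<subseteq> sphere 0 1" "sphere 0 1 \<subseteq> (\<Union>v\<in>M. ball v \<delta>)"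
    by (rule compactE_image[OF compact_sphere, of "sphere 0 1" "\<lambda>v. ball v \<delta>" 0 1])
      (use assms in \<open>auto intro!: bexI centre_in_ball[THEN iffD2]\<close>)
  show thesis
  proof (rule that[of "M \<union> uminus ` M"])
    show "\<exists>v\<in>M \<union> uminus ` M. dist v u < \<delta>" if "norm u = 1" for u
      using M(3) that by (fastforce simp: subset_iff)
  qed (use M(1,2) in auto)
qed

text \<open>Some net vector \<open>v\<close> is within \<open>\<delta>\<close> of the direction of
  \<open>x - y\<close>. Both points lie in the slab bounded by the supporting hyperplanes of
  \<open>K\<close> with normals \<open>v\<close> and \<open>- v\<close>, whose thickness is at most
  \<open>diameter K\<close>, while the component of \<open>x - y\<close> along \<open>v\<close> is
  at least \<open>(1 - \<delta>) * dist x y\<close>.\<close>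

lemma dist_circumscribed_le:
  fixes K :: "'a::euclidean_space set"
  assumes "bounded K" "K \<noteq> {}" "N \<subseteq> sphere 0 1"
    and sym: "\<And>v. v \<in> N \<Longrightarrow> - v \<in> N"
    and net: "\<And>u. norm u = 1 \<Longrightarrow> \<exists>v\<in>N. dist v u < \<delta>"
    and x: "x \<in> circumscribed K N" and y: "y \<in> circumscribed K N"
  shows "(1 - \<delta>) * dist x y \<le> diameter K"
proof (cases "x = y")
  case True
  then show ?thesis using diameter_ge_0[OF assms(1)] by simp
next
  case False
  define u where "u = (x - y) /\<^sub>R norm (x - y)"
  have u: "norm u = 1" "x - y = norm (x - y) *\<^sub>R u"
    using False by (simp_all add: u_def)
  obtain v where v: "v \<in> N" "dist v u < \<delta>"
    using net u(1) by blast
  have nv: "norm v = 1"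
    using v(1) assms(3) by auto
  have width: "v \<bullet> p + (- v) \<bullet> q \<le> diameter K" if "p \<in> K" "q \<in> K" for p q
  proof -
    have "v \<bullet> p + (- v) \<bullet> q = v \<bullet> (p - q)"
      by (simp add: inner_diff_right)
    also have "\<dots> \<le> dist p q"
      using norm_cauchy_schwarz[of v "p - q"] nv by (simp add: dist_norm)
    also have "\<dots> \<le> diameter K"
      using diameter_bounded_bound[OF assms(1)] that by blast
    finally show ?thesis .
  qed
  \<comment> \<open>The two suprema are taken one after the other: first over \<open>p\<close> with
    \<open>q\<close> fixed, then over \<open>q\<close>.\<close>
  have "(SUP p\<in>K. v \<bullet> p) \<le> diameter K - (- v) \<bullet> q" if "q \<in> K" for q
    using width[OF _ that] by (intro cSUP_least[OF assms(2)]) (simp add: algebra_simps)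
  then have SUP: "(SUP q\<in>K. (- v) \<bullet> q) \<le> diameter K - (SUP p\<in>K. v \<bullet> p)"
    by (intro cSUP_least[OF assms(2)]) (simp add: algebra_simps)
  have "1 - \<delta> \<le> u \<bullet> u - norm (u - v) * norm u"
    using v(2) u(1) by (simp add: dist_norm norm_minus_commute dot_square_norm)
  also have "\<dots> \<le> u \<bullet> u - (u - v) \<bullet> u"
    using norm_cauchy_schwarz[of "u - v" u] by simp
  also have "\<dots> = v \<bullet> u"
    by (simp add: inner_diff_left)
  finally have "(1 - \<delta>) * norm (x - y) \<le> (v \<bullet> u) * norm (x - y)"
    by (simp add: mult_right_mono)
  also have "\<dots> = v \<bullet> (x - y)"
    by (subst (2) u(2)) simp
  also have "\<dots> = v \<bullet> x + (- v) \<bullet> y"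
    by (simp add: inner_diff_right)
  also have "\<dots> \<le> (SUP p\<in>K. v \<bullet> p) + (SUP q\<in>K. (- v) \<bullet> q)"
    using x y v(1) sym[OF v(1)] unfolding circumscribed_def by (intro add_mono) blast+
  also have "\<dots> \<le> diameter K"
    using SUP by simp
  finally show ?thesis by (simp add: dist_norm)
qed

section \<open>Counting facets by halfspaces\<close>

text \<open>A subfamily of least cardinality with the same intersection is irredundant, and every
  facet is cut out by the bounding hyperplane of one of its members. The interior point makes the
  affine hull the whole space.\<close>

lemma card_facets_Inter_halfspaces_le:
  fixes H :: "'a::euclidean_space set set"
  assumes "finite H" "\<And>h. h \<in> H \<Longrightarrow> \<exists>a b. a \<noteq> 0 \<and> h = {x. a \<bullet> x \<le> b}"
    and "interior (\<Inter>H) \<noteq> {}"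
  shows "card {F. F facet_of \<Inter>H} \<le> card H"
proof -
  obtain G where G: "G \<subseteq> H" "\<Inter>G = \<Inter>H"
    and min: "\<And>G'. G' \<subseteq> H \<Longrightarrow> \<Inter>G' = \<Inter>H \<Longrightarrow> card G \<le> card G'"
    using ex_has_least_nat[of "\<lambda>G. G \<subseteq> H \<and> \<Inter>G = \<Inter>H" H card] by auto
  have fin: "finite G"
    using G(1) assms(1) finite_subset by blast
  obtain a b where ab: "\<And>h. h \<in> G \<Longrightarrow> a h \<noteq> 0 \<and> h = {x. a h \<bullet> x \<le> b h}"
    using assms(2) G(1) by (metis subsetD)
  have aff: "affine hull \<Inter>H = UNIV"
    using assms(3) by (rule affine_hull_nonempty_interior)
  have facet: "F facet_of \<Inter>H \<longleftrightarrow> (\<exists>h. h \<in> G \<and> F = \<Inter>H \<inter> {x. a h \<bullet> x = b h})" for F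
  proof (rule facet_of_polyhedron_explicit[OF fin])
    show "\<Inter>H = affine hull \<Inter>H \<inter> \<Inter>G"
      using aff G(2) by simp
    fix G' assume G': "G' \<subset> G"
    then have "card G' < card G"
      by (rule psubset_card_mono[OF fin])
    then have "\<Inter>G' \<noteq> \<Inter>H"
      using min[of G'] G' G(1) by auto
    moreover have "\<Inter>H \<subseteq> \<Inter>G'"
      using G' G(2) by blast
    ultimately show "\<Inter>H \<subset> affine hull \<Inter>H \<inter> \<Inter>G'"
      using aff by auto
  qed (rule ab)
  have "{F. F facet_of \<Inter>H} = (\<lambda>h. \<Inter>H \<inter> {x. a h \<bullet> x = b h}) ` G"
    by (simp only: facet image_def Bex_def)
  then have "card {F. F facet_of \<Inter>H} \<le> card G"
    by (simp only: card_image_le[OF fin])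
  also have "\<dots> \<le> card H"
    using G(1) assms(1) by (simp add: card_mono)
  finally show ?thesis .
qed

text \<open>In an irredundant representation distinct halfspaces cut out distinct facets. This
  injectivity bounds the number of halfspaces by the number of facets.\<close>

lemma polytope_facet_halfspaces:
  fixes P :: "'a::euclidean_space set"
  assumes "polytope P" "interior P \<noteq> {}"
  obtains H where "finite H" "P = \<Inter>H" "card H \<le> card {F. F facet_of P}"
    "\<And>h. h \<in> H \<Longrightarrow> \<exists>a b. a \<noteq> 0 \<and> h = {x. a \<bullet> x \<le> b}"
proof -
  have aff: "affine hull P = UNIV"
    using assms(2) by (rule affine_hull_nonempty_interior)
  have "polyhedron P"
    using assms(1) polytope_eq_bounded_polyhedron by blast
  then obtain H where fin: "finite H" and P: "P = affine hull P \<inter> \<Inter>H"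
    and half: "\<forall>h\<in>H. \<exists>a b. a \<noteq> 0 \<and> h = {x. a \<bullet> x \<le> b}"
    and min: "\<forall>H'. H' \<subset> H \<longrightarrow> P \<subset> affine hull P \<inter> \<Inter>H'"
    unfolding polyhedron_Int_affine_minimal by blast
  have PH: "P = \<Inter>H"
    using P aff by simp
  obtain a b where ab: "\<And>h. h \<in> H \<Longrightarrow> a h \<noteq> 0 \<and> h = {x. a h \<bullet> x \<le> b h}"
    using half by metis
  have mem: "x \<in> h \<longleftrightarrow> a h \<bullet> x \<le> b h" if "h \<in> H" for h x
    using ab[OF that] by (metis mem_Collect_eq)
  define c where "c h = P \<inter> {x. a h \<bullet> x = b h}" for h
  have facet: "F facet_of P \<longleftrightarrow> (\<exists>h. h \<in> H \<and> F = c h)" for F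
    unfolding c_def
  proof (rule facet_of_polyhedron_explicit[OF fin P])
    show "a h \<noteq> 0 \<and> h = {x. a h \<bullet> x \<le> b h}" if "h \<in> H" for h
      using that by (rule ab)
    show "P \<subset> affine hull P \<inter> \<Inter>H'" if "H' \<subset> H" for H'
      using min that by (elim allE impE)
  qed
  obtain z where z: "z \<in> interior P"
    using assms(2) by blast
  have zlt: "a h \<bullet> z < b h" if "h \<in> H" for h
  proof -
    have "P \<subseteq> {x. a h \<bullet> x \<le> b h}"
      using PH mem that by blast
    then have "interior P \<subseteq> interior {x. a h \<bullet> x \<le> b h}"
      by (rule interior_mono)
    also have "\<dots> = {x. a h \<bullet> x < b h}"
      using ab[OF that] by (intro interior_halfspace_le) (rule conjunct1)
    finally show ?thesis
      using z by auto
  qed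
  \<comment> \<open>Only \<open>h\<close> separates \<open>y\<close> from \<open>P\<close>, so the segment from \<open>z\<close> to \<open>y\<close> leaves \<open>P\<close> through the
    facet of \<open>h\<close>, at a point lying on no other facet.\<close>
  have "inj_on c H"
  proof (rule inj_onI, rule ccontr)
    fix h g assume h: "h \<in> H" and g: "g \<in> H" and eq: "c h = c g" and ne: "h \<noteq> g"
    have "H - {h} \<subset> H"
      using h by auto
    then have "P \<subset> \<Inter>(H - {h})"
      using min aff by simp
    then obtain y where y: "y \<in> \<Inter>(H - {h})" "y \<notin> P"
      by (blast dest: psubset_imp_ex_mem)
    have yle: "a k \<bullet> y \<le> b k" if "k \<in> H" "k \<noteq> h" for k
      using y(1) mem that by blast
    have ygt: "a h \<bullet> y > b h"
      using y PH mem[OF h] mem yle by (metis InterI not_le)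
    \<comment> \<open>The parameter at which the segment from \<open>z\<close> to \<open>y\<close>
      meets the bounding hyperplane of \<open>h\<close>; it lies strictly between 0 and 1 because
      \<open>z\<close> is strictly inside \<open>h\<close> and \<open>y\<close> is outside.\<close>
    define t where "t = (b h - a h \<bullet> z) / (a h \<bullet> y - a h \<bullet> z)"
    have t: "0 < t" "t < 1" "t * (a h \<bullet> y - a h \<bullet> z) = b h - a h \<bullet> z"
      using zlt[OF h] ygt by (auto simp: t_def)
    define x where "x = (1 - t) *\<^sub>R z + t *\<^sub>R y"
    have ax: "a k \<bullet> x = (1 - t) * (a k \<bullet> z) + t * (a k \<bullet> y)" for k
      by (simp add: x_def inner_add_right)
    have xh: "a h \<bullet> x = b h"
      using t(3) unfolding ax by (simp add: algebra_simps)
    have xk: "a k \<bullet> x < b k" if "k \<in> H" "k \<noteq> h" for k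
    proof -
      have "(1 - t) * (a k \<bullet> z) < (1 - t) * b k"
        using zlt[OF that(1)] t by simp
      moreover have "t * (a k \<bullet> y) \<le> t * b k"
        using yle[OF that] t by simp
      ultimately show ?thesis unfolding ax by (simp add: algebra_simps)
    qed
    have "x \<in> k" if "k \<in> H" for k
      using xh xk[OF that] mem[OF that] by (cases "k = h") (auto intro: less_imp_le)
    then have "x \<in> c h"
      using xh by (auto simp: c_def PH)
    moreover have "x \<notin> c g"
      using xk[OF g] ne by (auto simp: c_def)
    ultimately show False
      using eq by simp
  qed
  moreover have "c ` H = {F. F facet_of P}"
    by (simp only: facet image_def Bex_def)
  ultimately have "card H \<le> card {F. F facet_of P}"
    by (metis card_image order_refl)
  then show thesis
    using half by (intro that[OF fin PH]) blast+
qed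

lemma not_bounded_halfspace:
  fixes a :: "'a::real_inner"
  assumes "a \<noteq> 0"
  shows "\<not> bounded {x. a \<bullet> x \<le> b}"
proof
  assume "bounded {x. a \<bullet> x \<le> b}"
  then obtain B where B: "\<And>x. a \<bullet> x \<le> b \<Longrightarrow> norm x \<le> B"
    by (auto simp: bounded_iff)
  \<comment> \<open>The bound \<open>b\<close> puts \<open>x\<close> into the halfspace; the other
    bound forces \<open>norm x\<close> to be at least \<open>B + 1\<close> by
    Cauchy-Schwarz.\<close>
  define s where "s = min b (- ((B + 1) * norm a))"
  define x where "x = (s / (a \<bullet> a)) *\<^sub>R a"
  have ax: "a \<bullet> x = s"
    using assms by (simp add: x_def)
  then have "norm x \<le> B"
    by (intro B) (simp add: s_def)
  then have "norm a * norm x \<le> B * norm a"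
    by (simp add: mult.commute[of B] mult_left_mono)
  moreover have "- s \<le> norm a * norm x"
    using Cauchy_Schwarz_ineq2[of a x] ax by simp
  moreover have "s \<le> - (B * norm a) - norm a"
    by (simp add: s_def algebra_simps min_def)
  ultimately show False
    using assms by (smt (verit) zero_less_norm_iff)
qed

text \<open>With at most one facet, the polytope would be the whole space or a halfspace, and both
  are unbounded.\<close>

lemma two_le_card_facets:
  fixes P :: "'a::euclidean_space set"
  assumes "polytope P" "interior P \<noteq> {}"
  shows "2 \<le> card {F. F facet_of P}"
proof (rule ccontr)
  assume few: "\<not> 2 \<le> card {F. F facet_of P}"
  obtain H where H: "finite H" "P = \<Inter>H" "card H \<le> card {F. F facet_of P}"
    "\<And>h. h \<in> H \<Longrightarrow> \<exists>a b. a \<noteq> 0 \<and> h = {x. a \<bullet> x \<le> b}"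
    using polytope_facet_halfspaces[OF assms] by blast
  have bounded: "bounded (\<Inter>H)"
    using polytope_imp_bounded[OF assms(1)] H(2) by simp
  have "card H = 0 \<or> card H = 1"
    using few H(3) by linarith
  then consider "H = {}" | h where "H = {h}"
    using H(1) by (metis card_0_eq card_1_singletonE)
  then show False
  proof cases
    case 1
    then show False
      using bounded by simp
  next
    case 2
    then obtain a b where "a \<noteq> 0" "h = {x. a \<bullet> x \<le> b}"
      using H(4) by blast
    then show False
      using not_bounded_halfspace[OF \<open>a \<noteq> 0\<close>] bounded 2 by simp
  qed
qed

section \<open>Existence of the minimal number of facets\<close>

text \<open>The property minimised in \<open>n_diam\<close>, isolated so that it can be asserted at
  the minimum and denied just below it.\<close>

definition diam_approx :: "'a::euclidean_space itself \<Rightarrow> real \<Rightarrow> nat \<Rightarrow> bool" where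
  "diam_approx TYPE('a) \<epsilon> n \<longleftrightarrow>
     (\<forall>K :: 'a set. bounded K \<and> convex K \<and> 0 < emeasure lebesgue K \<longrightarrow>
        (\<exists>P. polytope P \<and> K \<subseteq> P \<and> card {F. F facet_of P} \<le> n
             \<and> ediam P \<le> ennreal (1 + \<epsilon>) * ediam K))"

lemma interior_nonempty_if_emeasure_pos:
  fixes K :: "'a::euclidean_space set"
  assumes "convex K" "0 < emeasure lebesgue K"
  shows "interior K \<noteq> {}"
proof
  assume "interior K = {}"
  then have "K \<in> null_sets lebesgue"
    using negligible_convex_interior[OF assms(1)] by (simp add: negligible_iff_null_sets)
  then show False
    using assms(2) by auto
qed

lemma emeasure_pos_open:
  fixes U :: "'a::euclidean_space set"
  assumes "open U" "U \<noteq> {}"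
  shows "0 < emeasure lebesgue U"
  using open_not_negligible[OF assms] negligible_iff_emeasure0[of U] assms(1)
  by (simp add: zero_less_iff_neq_zero)

text \<open>Tested on the unit ball. The bound yields \<open>DIM('a) + 1 \<le> n * DIM('a)\<close>,
  as Helly's theorem needs, and keeps the natural-number difference \<open>n - 1\<close> strictly
  below \<open>n\<close>.\<close>

lemma two_le_if_diam_approx:
  assumes "diam_approx TYPE('a::euclidean_space) \<epsilon> n"
  shows "2 \<le> n"
proof -
  obtain P :: "'a set" where P: "polytope P" "ball 0 1 \<subseteq> P" "card {F. F facet_of P} \<le> n"
    using assms emeasure_pos_open[of "ball (0::'a) 1"] unfolding diam_approx_def
    by (metis bounded_ball convex_ball open_ball ball_eq_empty not_one_le_zero)
  have "interior P \<noteq> {}"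
    using interior_maximal[OF P(2) open_ball] by force
  then show ?thesis
    using two_le_card_facets[OF P(1)] P(3) by linarith
qed

lemma circumscribed_eq_Inter:
  "circumscribed K N = \<Inter>((\<lambda>v. {x. v \<bullet> x \<le> (SUP y\<in>K. v \<bullet> y)}) ` N)"
  by (auto simp: circumscribed_def)

lemma polyhedron_circumscribed:
  fixes K :: "'a::euclidean_space set"
  assumes "finite N"
  shows "polyhedron (circumscribed K N)"
  unfolding circumscribed_eq_Inter using assms by (auto intro: polyhedron_halfspace_le)

lemma card_facets_circumscribed_le:
  fixes K :: "'a::euclidean_space set"
  assumes "finite N" "0 \<notin> N" "bounded K" "interior K \<noteq> {}"
  shows "card {F. F facet_of circumscribed K N} \<le> card N"
proof -
  let ?H = "(\<lambda>v. {x. v \<bullet> x \<le> (SUP y\<in>K. v \<bullet> y)}) ` N"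
  have "interior (\<Inter>?H) \<noteq> {}"
    using interior_mono[OF subset_circumscribed[OF assms(3), of N]] assms(4)
    by (auto simp: circumscribed_eq_Inter)
  then have "card {F. F facet_of \<Inter>?H} \<le> card ?H"
  proof (rule card_facets_Inter_halfspaces_le[rotated 2])
    show "finite ?H"
      using assms(1) by simp
    fix h assume "h \<in> ?H"
    then obtain v where "v \<in> N" "h = {x. v \<bullet> x \<le> (SUP y\<in>K. v \<bullet> y)}"
      by (rule imageE)
    then show "\<exists>a b. a \<noteq> 0 \<and> h = {x. a \<bullet> x \<le> b}"
      using assms(2) by metis
  qed
  also have "\<dots> \<le> card N"
    using assms(1) by (rule card_image_le)
  finally show ?thesis
    by (simp add: circumscribed_eq_Inter)
qed

text \<open>Without a witness, the \<open>LEAST\<close> in \<open>n_diam\<close> would be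
  unspecified. The size of one fixed net serves, since it depends on \<open>\<epsilon>\<close> and
  the space but not on \<open>K\<close>.\<close>

lemma ex_diam_approx:
  assumes "\<epsilon> > 0"
  shows "\<exists>n. diam_approx TYPE('a::euclidean_space) \<epsilon> n"
proof -
  \<comment> \<open>Chosen so that the factor \<open>1 / (1 - \<delta>)\<close> lost by the net is
    exactly \<open>1 + \<epsilon>\<close>.\<close>
  define \<delta> where "\<delta> = \<epsilon> / (1 + \<epsilon>)"
  have \<delta>: "0 < \<delta>" "1 - \<delta> = 1 / (1 + \<epsilon>)"
    using assms by (simp_all add: \<delta>_def field_simps)
  obtain N :: "'a set" where N: "finite N" "N \<subseteq> sphere 0 1" "\<And>v. v \<in> N \<Longrightarrow> - v \<in> N"
    "\<And>u. norm u = 1 \<Longrightarrow> \<exists>v\<in>N. dist v u < \<delta>"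
    using symmetric_sphere_net[OF \<delta>(1)] by metis
  have "\<exists>P. polytope P \<and> K \<subseteq> P \<and> card {F. F facet_of P} \<le> card N
             \<and> ediam P \<le> ennreal (1 + \<epsilon>) * ediam K"
    if K: "bounded K" "convex K" "0 < emeasure lebesgue K" for K :: "'a set"
  proof (intro exI conjI)
    let ?P = "circumscribed K N"
    have int: "interior K \<noteq> {}"
      using K by (intro interior_nonempty_if_emeasure_pos)
    have "dist x y \<le> (1 + \<epsilon>) * diameter K" if "x \<in> ?P" "y \<in> ?P" for x y
    proof -
      have "K \<noteq> {}"
        using int by auto
      then show ?thesis
        using dist_circumscribed_le[OF K(1) _ N(2-4) that] assms by (simp add: \<delta>(2) field_simps)
    qed
    then have dist: "\<forall>x\<in>?P. \<forall>y\<in>?P. dist x y \<le> (1 + \<epsilon>) * diameter K"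
      by blast
    then show "polytope ?P"
      unfolding polytope_eq_bounded_polyhedron bounded_two_points
      using polyhedron_circumscribed[OF N(1)] by blast
    show "K \<subseteq> ?P"
      by (rule subset_circumscribed[OF K(1)])
    show "card {F. F facet_of ?P} \<le> card N"
      using N(1,2) K(1) int by (intro card_facets_circumscribed_le) auto
    have "ediam ?P \<le> ennreal ((1 + \<epsilon>) * diameter K)"
      using dist assms by (subst ediam_le_iff) (auto simp: diameter_ge_0[OF K(1)])
    then show "ediam ?P \<le> ennreal (1 + \<epsilon>) * ediam K"
      using assms by (simp add: ediam_bounded[OF K(1)] ennreal_mult diameter_ge_0[OF K(1)])
  qed
  then show ?thesis
    unfolding diam_approx_def by blast
qed

section \<open>The Helly-type bound\<close>

text \<open>Adding the open complement \<open>H\<close> of the halfspace makes the intersection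
  empty, so by Helly some \<open>DIM('a) + 1\<close> members already have empty intersection. One of
  them is \<open>H\<close>, because the members of \<open>\<F>\<close> have a common point; the
  others are the required subfamily.\<close>

lemma Helly_halfspace:
  fixes \<F> :: "'a::euclidean_space set set"
  assumes "finite \<F>" "\<And>C. C \<in> \<F> \<Longrightarrow> convex C" "\<Inter>\<F> \<noteq> {}" "\<Inter>\<F> \<subseteq> {x. a \<bullet> x \<le> b}"
  obtains \<G> where "\<G> \<subseteq> \<F>" "card \<G> \<le> DIM('a)" "\<Inter>\<G> \<subseteq> {x. a \<bullet> x \<le> b}"
proof -
  define H where "H = {x. a \<bullet> x > b}"
  have sub_iff: "S \<subseteq> {x. a \<bullet> x \<le> b} \<longleftrightarrow> H \<inter> S = {}" for S
    by (force simp: H_def)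
  then have disj: "H \<inter> \<Inter>\<F> = {}"
    using assms(4) by simp
  then have "H \<notin> \<F>"
    using assms(3) Inter_lower[of H \<F>] by auto
  show thesis
  proof (cases "card \<F> \<le> DIM('a)")
    case True
    then show thesis using that[of \<F>] assms(4) by simp
  next
    case False
    have "\<exists>t. t \<subseteq> insert H \<F> \<and> card t = DIM('a) + 1 \<and> \<Inter>t = {}"
    proof (rule ccontr)
      assume neg: "\<nexists>t. t \<subseteq> insert H \<F> \<and> card t = DIM('a) + 1 \<and> \<Inter>t = {}"
      have "\<Inter>(insert H \<F>) \<noteq> {}"
      proof (rule Helly)
        show "DIM('a) + 1 \<le> card (insert H \<F>)"
          using False assms(1) \<open>H \<notin> \<F>\<close> by simp
        show "\<forall>s\<in>insert H \<F>. convex s"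
          using assms(2) by (simp add: H_def convex_halfspace_gt)
        show "\<Inter>t \<noteq> {}" if "t \<subseteq> insert H \<F>" "card t = DIM('a) + 1" for t
          using neg[unfolded not_ex, rule_format, of t] that by simp
      qed
      with disj show False by simp
    qed
    then obtain t where t: "t \<subseteq> insert H \<F>" "card t = DIM('a) + 1" "\<Inter>t = {}"
      by blast
    have "H \<in> t"
      using t(1,3) assms(3) Inter_anti_mono[of t \<F>] by (metis subset_empty subset_insert)
    then have "card (t - {H}) \<le> DIM('a)"
      using t(2) by simp
    moreover have "\<Inter>(t - {H}) \<inter> H = {}"
      using t(3) \<open>H \<in> t\<close> by (metis Inter_insert Int_commute insert_Diff)
    then have "\<Inter>(t - {H}) \<subseteq> {x. a \<bullet> x \<le> b}"
      unfolding sub_iff by (simp only: Int_commute)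
    ultimately show thesis
      using that[of "t - {H}"] t(1) \<open>H \<in> t\<close> by (simp add: subset_insert_iff)
  qed
qed

text \<open>The intersection of the family may have volume zero, whereas \<open>diam_approx\<close>
  speaks only of sets of positive volume. The sum with a small open ball has positive volume, and
  the strict inequality leaves room for it.\<close>

lemma convex_body_thickening:
  fixes K :: "'a::euclidean_space set"
  assumes "bounded K" "K \<noteq> {}" "convex K" "diameter K < r"
  obtains L where "K \<subseteq> L" "bounded L" "convex L" "0 < emeasure lebesgue L" "diameter L < r"
proof -
  \<comment> \<open>The diameter grows by at most \<open>2 * \<delta>\<close>; a third of the slack
    keeps the final inequality strict.\<close>
  define \<delta> where "\<delta> = (r - diameter K) / 3"
  have \<delta>: "\<delta> > 0" "diameter K + 2 * \<delta> < r"
    using assms(4) by (auto simp: \<delta>_def field_simps)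
  define L where "L = (\<Union>x\<in>K. \<Union>y\<in>ball 0 \<delta>. {x + y})"
  have "open L"
    unfolding L_def by (intro open_sums) auto
  have sub: "K \<subseteq> L"
    using \<delta>(1) by (force simp: L_def)
  have dist: "dist p q \<le> diameter K + 2 * \<delta>" if "p \<in> L" "q \<in> L" for p q
  proof -
    obtain x y x' y' where *: "x \<in> K" "x' \<in> K" "norm y < \<delta>" "norm y' < \<delta>"
      "p = x + y" "q = x' + y'"
      using \<open>p \<in> L\<close> \<open>q \<in> L\<close> by (auto simp: L_def)
    have "dist p q \<le> dist x x' + dist y y'"
      unfolding *(5,6) by (rule dist_triangle_add)
    also have "dist x x' \<le> diameter K"
      using diameter_bounded_bound[OF assms(1)] * by blast
    also have "dist y y' \<le> 2 * \<delta>"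
      using norm_triangle_ineq4[of y y'] *(3,4) by (simp add: dist_norm)
    finally show ?thesis by simp
  qed
  show thesis
  proof (rule that[OF sub])
    show "bounded L"
      using dist unfolding bounded_two_points by blast
    show "convex L"
      unfolding L_def using assms(3) by (intro convex_sums) auto
    show "0 < emeasure lebesgue L"
      using \<open>open L\<close> sub assms(2) by (intro emeasure_pos_open) auto
    have "diameter L \<le> diameter K + 2 * \<delta>"
      using dist sub assms(2) by (intro diameter_le) (auto simp: dist_norm)
    then show "diameter L < r"
      using \<delta>(2) by simp
  qed
qed

lemma diameter_Helly:
  fixes \<F> :: "'a::euclidean_space set set"
  assumes "\<epsilon> > 0" "diam_approx TYPE('a) \<epsilon> n" "finite \<F>" "\<And>C. C \<in> \<F> \<Longrightarrow> convex C"
    and sub: "\<And>\<F>'. \<F>' \<subseteq> \<F> \<Longrightarrow> card \<F>' \<le> n * DIM('a) \<Longrightarrow> 1 \<le> ediam (\<Inter>\<F>')"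
  shows "ennreal (inverse (1 + \<epsilon>)) \<le> ediam (\<Inter>\<F>)"
proof (rule ccontr)
  define K where "K = \<Inter>\<F>"
  define r where "r = inverse (1 + \<epsilon>)"
  assume "\<not> ennreal (inverse (1 + \<epsilon>)) \<le> ediam (\<Inter>\<F>)"
  then have small: "ediam K < ennreal r"
    by (simp add: K_def r_def)
  have r: "0 < r" "r < 1"
    using assms(1) by (auto simp: r_def field_simps)
  show False
  \<comment> \<open>\<open>Helly_halfspace\<close> needs a common point. If there is none, Helly's
    theorem itself (or \<open>\<F>\<close>, when it is small) gives an admissible subfamily with
    empty intersection, whose extended diameter is 0.\<close>
  proof (cases "K = {}")
    case True
    have "1 * DIM('a) < n * DIM('a)"
      using two_le_if_diam_approx[OF assms(2)] by (intro mult_strict_right_mono) auto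
    then have n: "DIM('a) + 1 \<le> n * DIM('a)"
      by linarith
    have "\<exists>t\<subseteq>\<F>. card t \<le> n * DIM('a) \<and> \<Inter>t = {}"
    proof (cases "DIM('a) + 1 \<le> card \<F>")
      case True
      then show ?thesis
        using Helly[of \<F>] assms(4) \<open>K = {}\<close> n unfolding K_def by metis
    next
      case False
      then show ?thesis
        using n \<open>K = {}\<close> unfolding K_def by (intro exI[of _ \<F>]) auto
    qed
    then obtain t where "t \<subseteq> \<F>" "card t \<le> n * DIM('a)" "\<Inter>t = {}"
      by blast
    with sub[of t] show False
      by (simp add: ediam_def bot_ennreal)
  next
    case False
    have bK: "bounded K"
      using small ediam_unbounded[of K] by (cases "bounded K") auto
    have "diameter K < r"
      using small r by (simp add: ediam_bounded[OF bK] ennreal_less_iff diameter_ge_0[OF bK])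
    moreover have "convex K"
      unfolding K_def using assms(4) by (intro convex_Inter) auto
    ultimately obtain L where L: "K \<subseteq> L" "bounded L" "convex L" "0 < emeasure lebesgue L"
      "diameter L < r"
      using convex_body_thickening[OF bK False] by blast
    obtain P where P: "polytope P" "L \<subseteq> P" "card {F. F facet_of P} \<le> n"
      "ediam P \<le> ennreal (1 + \<epsilon>) * ediam L"
      using assms(2) L(2-4) unfolding diam_approx_def by blast
    have "interior P \<noteq> {}"
      using interior_nonempty_if_emeasure_pos[OF L(3,4)] interior_mono[OF P(2)] by blast
    then obtain H where H: "finite H" "P = \<Inter>H" "card H \<le> card {F. F facet_of P}"
      "\<And>h. h \<in> H \<Longrightarrow> \<exists>a b. a \<noteq> 0 \<and> h = {x. a \<bullet> x \<le> b}"
      using polytope_facet_halfspaces[OF P(1)] by blast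
    have "\<exists>\<G>\<subseteq>\<F>. card \<G> \<le> DIM('a) \<and> \<Inter>\<G> \<subseteq> h" if h: "h \<in> H" for h
    proof -
      obtain a b where h_eq: "h = {x. a \<bullet> x \<le> b}"
        using H(4)[OF h] by blast
      have "\<Inter>\<F> \<subseteq> h"
        using L(1) P(2) H(2) h by (auto simp: K_def)
      then show ?thesis
        using Helly_halfspace[OF assms(3,4), of a b] False unfolding K_def h_eq by metis
    qed
    then obtain \<G> where \<G>: "\<And>h. h \<in> H \<Longrightarrow> \<G> h \<subseteq> \<F> \<and> card (\<G> h) \<le> DIM('a) \<and> \<Inter>(\<G> h) \<subseteq> h"
      by metis
    have "card (\<Union>h\<in>H. \<G> h) \<le> (\<Sum>h\<in>H. card (\<G> h))"
      by (rule card_UN_le[OF H(1)])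
    also have "\<dots> \<le> (\<Sum>h\<in>H. DIM('a))"
      using \<G> by (intro sum_mono) blast
    also have "\<dots> \<le> n * DIM('a)"
      using H(3) P(3) by simp
    finally have "1 \<le> ediam (\<Inter>(\<Union>h\<in>H. \<G> h))"
      using \<G> by (intro sub) auto
    also have "\<dots> \<le> ediam P"
    proof (rule ediam_mono)
      have "\<Inter>(\<Union>h\<in>H. \<G> h) \<subseteq> h" if "h \<in> H" for h
        using Inter_anti_mono[OF UN_upper[OF that, of \<G>]] \<G>[OF that] by (meson order_trans)
      then show "\<Inter>(\<Union>h\<in>H. \<G> h) \<subseteq> P"
        unfolding H(2) by (rule Inter_greatest)
    qed
    also have "\<dots> \<le> ennreal ((1 + \<epsilon>) * diameter L)"
      using P(4) assms(1) by (simp add: ediam_bounded[OF L(2)] ennreal_mult diameter_ge_0[OF L(2)])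
    finally have "1 \<le> (1 + \<epsilon>) * diameter L"
      by simp
    moreover have "(1 + \<epsilon>) * diameter L < 1"
      using L(5) assms(1) by (simp add: r_def field_simps)
    ultimately show False
      by simp
  qed
qed

section \<open>A uniform gap by compactness\<close>

text \<open>Tuples of length \<open>m\<close> are encoded as sequences of which only the first
  \<open>m\<close> entries have to converge. The subsequence is refined once per coordinate, by
  induction on \<open>m\<close>.\<close>

lemma compact_finite_tuples_convergent_subseq:
  fixes f :: "nat \<Rightarrow> nat \<Rightarrow> 'a::metric_space"
  assumes "compact S" "\<And>k i. f k i \<in> S"
  obtains l r where "strict_mono (r :: nat \<Rightarrow> nat)" "\<And>i. l i \<in> S"
    "\<And>i. i < m \<Longrightarrow> (\<lambda>k. f (r k) i) \<longlonglongrightarrow> l i"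
proof -
  have "\<exists>l r. strict_mono (r :: nat \<Rightarrow> nat) \<and> (\<forall>i. l i \<in> S) \<and>
          (\<forall>i<m. (\<lambda>k. f (r k) i) \<longlonglongrightarrow> l i)"
  proof (induction m)
    case 0
    show ?case
      using assms(2) by (intro exI[of _ "f 0"] exI[of _ id]) (auto simp: strict_mono_def)
  next
    case (Suc m)
    then obtain l r where lr: "strict_mono (r :: nat \<Rightarrow> nat)" "\<And>i. l i \<in> S"
      "\<And>i. i < m \<Longrightarrow> (\<lambda>k. f (r k) i) \<longlonglongrightarrow> l i"
      by blast
    obtain p s where ps: "p \<in> S" "strict_mono (s :: nat \<Rightarrow> nat)" "((\<lambda>k. f (r k) m) \<circ> s) \<longlonglongrightarrow> p"
      using assms unfolding compact_eq_seq_compact_metric by (elim seq_compactE) auto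
    have "(\<lambda>k. f ((r \<circ> s) k) i) \<longlonglongrightarrow> (l(m := p)) i" if "i < Suc m" for i
      using that ps(3) LIMSEQ_subseq_LIMSEQ[OF lr(3) ps(2)]
      by (cases "i = m") (auto simp: o_def less_Suc_eq)
    then show ?case
      using lr(2) ps(1) strict_mono_o[OF lr(1) ps(2)]
      by (intro exI[of _ "l(m := p)"] exI[of _ "r \<circ> s"]) (auto simp del: o_apply)
  qed
  then show thesis
    using that by blast
qed

text \<open>Without a gap there are direction tuples whose circumscribed sets have diameters at most
  \<open>c + 1 / (k + 1)\<close>. A limit tuple \<open>l\<close> then has a circumscribed set of
  diameter at most \<open>c\<close>, against \<open>large\<close>. The argument runs through pairs
  of points, as these sets need not be known to be bounded.\<close>

lemma circumscribed_diameter_gap: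
  fixes K :: "'a::euclidean_space set"
  assumes "bounded K" "interior K \<noteq> {}"
    and large: "\<And>u :: nat \<Rightarrow> 'a. (\<And>i. norm (u i) = 1) \<Longrightarrow>
      \<exists>x\<in>circumscribed K (u ` {..<m}). \<exists>y\<in>circumscribed K (u ` {..<m}). c < dist x y"
  obtains \<eta> where "\<eta> > 0" "\<And>u :: nat \<Rightarrow> 'a. (\<And>i. norm (u i) = 1) \<Longrightarrow>
      \<exists>x\<in>circumscribed K (u ` {..<m}). \<exists>y\<in>circumscribed K (u ` {..<m}). c + \<eta> < dist x y"
proof -
  let ?C = "\<lambda>u :: nat \<Rightarrow> 'a. circumscribed K (u ` {..<m})"
  have "\<exists>\<eta>>0. \<forall>u. (\<forall>i. norm (u i) = 1) \<longrightarrow> (\<exists>x\<in>?C u. \<exists>y\<in>?C u. c + \<eta> < dist x y)"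
  proof (rule ccontr)
    assume neg: "\<not> ?thesis"
    have "\<exists>u. (\<forall>i. norm (u i) = 1) \<and> (\<forall>x\<in>?C u. \<forall>y\<in>?C u. dist x y \<le> c + inverse (real (Suc k)))"
      for k
      using neg[unfolded not_ex, rule_format, of "inverse (real (Suc k))"]
      by (auto simp: not_less simp del: of_nat_Suc)
    then obtain f where f: "\<And>k i. norm (f k i) = 1"
      "\<And>k x y. x \<in> ?C (f k) \<Longrightarrow> y \<in> ?C (f k) \<Longrightarrow> dist x y \<le> c + inverse (real (Suc k))"
      by metis
    obtain l r where lr: "strict_mono (r :: nat \<Rightarrow> nat)" "\<And>i. l i \<in> sphere 0 1"
      "\<And>i. i < m \<Longrightarrow> (\<lambda>k. f (r k) i) \<longlonglongrightarrow> l i"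
      by (rule compact_finite_tuples_convergent_subseq[of "sphere 0 1" f m]) (use f(1) in auto)
    obtain z where z: "z \<in> interior K"
      using assms(2) by blast
    \<comment> \<open>Pushing a point of the limit body towards \<open>z\<close> makes all its inequalities strict, so the
      point survives small perturbations of the directions.\<close>
    have push: "\<forall>\<^sub>F k in sequentially. (1 - t) *\<^sub>R x + t *\<^sub>R z \<in> ?C (f (r k))"
      if x: "x \<in> ?C l" and t: "0 < t" "t < 1" for x t
    proof -
      let ?w = "(1 - t) *\<^sub>R x + t *\<^sub>R z"
      have "\<forall>\<^sub>F k in sequentially. f (r k) i \<bullet> ?w < (SUP y\<in>K. f (r k) i \<bullet> y)" if i: "i < m" for i
      proof -
        have "l i \<bullet> x \<le> (SUP y\<in>K. l i \<bullet> y)"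
          using x i by (auto simp: circumscribed_def)
        moreover have "l i \<bullet> z < (SUP y\<in>K. l i \<bullet> y)"
          using lr(2)[of i] by (intro inner_interior_less_SUP[OF assms(1) z]) auto
        ultimately have "(1 - t) * (l i \<bullet> x) + t * (l i \<bullet> z)
            < (1 - t) * (SUP y\<in>K. l i \<bullet> y) + t * (SUP y\<in>K. l i \<bullet> y)"
          using t by (intro add_le_less_mono) auto
        then have "l i \<bullet> ?w < (SUP y\<in>K. l i \<bullet> y)"
          by (simp add: inner_add_right algebra_simps)
        \<comment> \<open>One point \<open>y\<close> of \<open>K\<close> that beats
          \<open>?w\<close> strictly in direction \<open>l i\<close> still beats it in all nearby
          directions; this takes the place of continuity of the support function.\<close>
        then obtain y where y: "y \<in> K" "l i \<bullet> ?w < l i \<bullet> y"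
          using less_cSUP_iff[OF _ bdd_above_inner_image[OF assms(1)]] z interior_subset by blast
        have "(\<lambda>k. f (r k) i \<bullet> (y - ?w)) \<longlonglongrightarrow> l i \<bullet> (y - ?w)"
          by (intro tendsto_intros lr(3)[OF i])
        moreover have "0 < l i \<bullet> (y - ?w)"
          using y(2) by (simp add: inner_diff_right)
        ultimately have "\<forall>\<^sub>F k in sequentially. 0 < f (r k) i \<bullet> (y - ?w)"
          by (rule order_tendstoD)
        then show ?thesis
        proof eventually_elim
          case (elim k)
          then have "f (r k) i \<bullet> ?w < f (r k) i \<bullet> y"
            by (simp add: inner_diff_right)
          also have "\<dots> \<le> (SUP y\<in>K. f (r k) i \<bullet> y)"
            by (rule cSUP_upper[OF y(1) bdd_above_inner_image[OF assms(1)]])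
          finally show ?case .
        qed
      qed
      then have "\<forall>\<^sub>F k in sequentially. \<forall>i\<in>{..<m}. f (r k) i \<bullet> ?w < (SUP y\<in>K. f (r k) i \<bullet> y)"
        by (intro eventually_ball_finite) auto
      then show ?thesis
        by eventually_elim (auto simp: circumscribed_def intro: less_imp_le)
    qed
    \<comment> \<open>Two limits in succession: first \<open>k\<close> tends to infinity with
      \<open>t\<close> fixed, then \<open>t\<close> tends to 0.\<close>
    have shrunk: "(1 - t) * dist x y \<le> c" if "x \<in> ?C l" "y \<in> ?C l" "0 < t" "t < 1" for x y t
    proof (rule tendsto_lowerbound)
      have "(\<lambda>k. c + inverse (real (Suc (r k)))) \<longlonglongrightarrow> c + 0"
        using LIMSEQ_subseq_LIMSEQ[OF LIMSEQ_inverse_real_of_nat lr(1)]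
        by (intro tendsto_add tendsto_const) (simp add: o_def)
      then show "(\<lambda>k. c + inverse (real (Suc (r k)))) \<longlonglongrightarrow> c"
        by simp
      show "\<forall>\<^sub>F k in sequentially. (1 - t) * dist x y \<le> c + inverse (real (Suc (r k)))"
        using push[OF that(1,3,4)] push[OF that(2,3,4)]
      proof eventually_elim
        case (elim k)
        have "dist ((1 - t) *\<^sub>R x + t *\<^sub>R z) ((1 - t) *\<^sub>R y + t *\<^sub>R z) = (1 - t) * dist x y"
          using that(4) by (simp add: dist_norm flip: scaleR_diff_right)
        then show ?case
          using f(2)[OF elim] by simp
      qed
    qed simp
    have "dist x y \<le> c" if "x \<in> ?C l" "y \<in> ?C l" for x y
    proof (rule tendsto_upperbound)
      show "((\<lambda>t. (1 - t) * dist x y) \<longlongrightarrow> dist x y) (at_right 0)"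
        by (auto intro!: tendsto_eq_intros)
      show "\<forall>\<^sub>F t in at_right 0. (1 - t) * dist x y \<le> c"
        using eventually_at_right_real[of 0 1] shrunk[OF that]
        by (auto elim: eventually_mono)
    qed simp
    moreover have "\<exists>x\<in>?C l. \<exists>y\<in>?C l. c < dist x y"
      using lr(2) by (intro large) auto
    ultimately show False
      by (meson not_less)
  qed
  then show thesis
    using that by blast
qed

section \<open>The family showing sharpness\<close>

text \<open>Padding with \<open>e\<close> turns a set of at most \<open>m\<close> directions into an
  \<open>m\<close>-tuple, the form in which the gap is stated.\<close>

lemma finite_subset_tuple:
  assumes "finite N" "card N \<le> m" "N \<subseteq> S" "e \<in> S"
  obtains u :: "nat \<Rightarrow> 'a" where "N \<subseteq> u ` {..<m}" "\<And>i. u i \<in> S"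
proof -
  obtain g where g: "bij_betw g {0..<card N} N"
    using ex_bij_betw_nat_finite[OF assms(1)] by blast
  define u where "u i = (if i < card N then g i else e)" for i
  have "g i \<in> N" if "i < card N" for i
    using bij_betwE[OF g] that by auto
  then have "u i \<in> S" for i
    using assms(3,4) by (auto simp: u_def)
  moreover have "N \<subseteq> u ` {..<m}"
  proof
    fix v assume "v \<in> N"
    then obtain i where "i < card N" "g i = v"
      using bij_betw_imp_surj_on[OF g] by (metis atLeastLessThan_iff imageE)
    then show "v \<in> u ` {..<m}"
      using assms(2) by (intro image_eqI[of _ _ i]) (auto simp: u_def)
  qed
  ultimately show thesis
    using that by blast
qed

text \<open>With \<open>s = c + \<eta>\<close>, any \<open>m\<close> supporting halfspaces of
  \<open>K\<close> leave a set of diameter above \<open>s\<close>, while a fine net of them leaves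
  diameter at most \<open>diameter K / (1 - \<delta>)\<close>. Scaling by \<open>1 / s\<close> puts
  the first above 1 and the second below \<open>1 / (1 + \<epsilon>)\<close>.\<close>

lemma not_diam_approx_family:
  assumes "\<epsilon> > 0" "\<not> diam_approx TYPE('a::euclidean_space) \<epsilon> m"
  obtains \<F> :: "'a::euclidean_space set set" where "finite \<F>" "\<And>C. C \<in> \<F> \<Longrightarrow> convex C"
    "\<And>\<F>'. \<F>' \<subseteq> \<F> \<Longrightarrow> card \<F>' \<le> m \<Longrightarrow> 1 \<le> ediam (\<Inter>\<F>')"
    "ediam (\<Inter>\<F>) < ennreal (inverse (1 + \<epsilon>))"
proof -
  obtain K :: "'a set" where K: "bounded K" "convex K" "0 < emeasure lebesgue K"
    and bad: "\<And>P. polytope P \<Longrightarrow> K \<subseteq> P \<Longrightarrow> card {F. F facet_of P} \<le> m \<Longrightarrow>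
      \<not> ediam P \<le> ennreal (1 + \<epsilon>) * ediam K"
    using assms(2) unfolding diam_approx_def by blast
  define c where "c = (1 + \<epsilon>) * diameter K"
  have c: "0 \<le> c" "ennreal (1 + \<epsilon>) * ediam K = ennreal c"
    using assms(1) diameter_ge_0[OF K(1)] by (simp_all add: c_def ediam_bounded[OF K(1)] ennreal_mult)
  have int: "interior K \<noteq> {}"
    by (rule interior_nonempty_if_emeasure_pos[OF K(2,3)])
  \<comment> \<open>Otherwise the circumscribed polyhedron would be bounded, hence a polytope with
    at most \<open>m\<close> facets of the kind excluded by \<open>bad\<close>.\<close>
  have "\<exists>x\<in>circumscribed K (u ` {..<m}). \<exists>y\<in>circumscribed K (u ` {..<m}). c < dist x y"
    if u: "\<And>i. norm (u i) = 1" for u :: "nat \<Rightarrow> 'a"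
  proof (rule ccontr)
    let ?P = "circumscribed K (u ` {..<m})"
    assume "\<not> ?thesis"
    then have le: "\<forall>x\<in>?P. \<forall>y\<in>?P. dist x y \<le> c"
      by (auto simp: not_less)
    then have "polytope ?P"
      unfolding polytope_eq_bounded_polyhedron bounded_two_points
      using polyhedron_circumscribed[of "u ` {..<m}" K] by blast
    moreover have "card {F. F facet_of ?P} \<le> m"
    proof -
      have "0 \<notin> u ` {..<m}"
        using u by (metis imageE norm_zero zero_neq_one)
      then have "card {F. F facet_of ?P} \<le> card (u ` {..<m})"
        by (intro card_facets_circumscribed_le K(1) int) auto
      also have "\<dots> \<le> m"
        using card_image_le[of "{..<m}" u] by simp
      finally show ?thesis .
    qed
    moreover have "ediam ?P \<le> ennreal (1 + \<epsilon>) * ediam K"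
      using le c by (simp add: ediam_le_iff)
    ultimately show False
      using bad subset_circumscribed[OF K(1)] by blast
  qed
  then obtain \<eta> where \<eta>: "\<eta> > 0" and gap: "\<And>u :: nat \<Rightarrow> 'a. (\<And>i. norm (u i) = 1) \<Longrightarrow>
      \<exists>x\<in>circumscribed K (u ` {..<m}). \<exists>y\<in>circumscribed K (u ` {..<m}). c + \<eta> < dist x y"
    using circumscribed_diameter_gap[OF K(1) int, of m c] by blast
  \<comment> \<open>Makes \<open>(1 - \<delta>) * (c + \<eta>)\<close> equal to
    \<open>c + \<eta> / 2\<close>, so half of the gap survives the error of the net.\<close>
  define \<delta> where "\<delta> = \<eta> / (2 * (c + \<eta>))"
  define s where "s = c + \<eta>"
  have s: "0 < s" and \<delta>: "0 < \<delta>" "(1 - \<delta>) * s = c + \<eta> / 2" "\<delta> < 1"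
    using \<eta> c(1) by (auto simp: \<delta>_def s_def field_simps)
  obtain N :: "'a set" where N: "finite N" "N \<subseteq> sphere 0 1" "\<And>v. v \<in> N \<Longrightarrow> - v \<in> N"
    "\<And>u. norm u = 1 \<Longrightarrow> \<exists>v\<in>N. dist v u < \<delta>"
    using symmetric_sphere_net[OF \<delta>(1)] by metis
  define h where "h v = {x. v \<bullet> (s *\<^sub>R x) \<le> (SUP y\<in>K. v \<bullet> y)}" for v
  have h: "x \<in> \<Inter>(h ` M) \<longleftrightarrow> s *\<^sub>R x \<in> circumscribed K M" for x M
    by (auto simp: h_def circumscribed_def)
  show thesis
  proof (rule that[of "h ` N"])
    show "finite (h ` N)"
      using N(1) by simp
    show "convex C" if "C \<in> h ` N" for C
    proof -
      obtain v where "C = {x. (s *\<^sub>R v) \<bullet> x \<le> (SUP y\<in>K. v \<bullet> y)}"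
        using \<open>C \<in> h ` N\<close> by (auto simp: h_def)
      then show ?thesis
        by (simp only: convex_halfspace_le)
    qed
    show "1 \<le> ediam (\<Inter>\<F>')" if \<F>': "\<F>' \<subseteq> h ` N" "card \<F>' \<le> m" for \<F>'
    proof -
      \<comment> \<open>Different directions are not known to give different sets
        \<open>h v\<close>; picking one direction per member keeps the number of directions at
        \<open>card \<F>'\<close>.\<close>
      obtain M where M: "M \<subseteq> N" "inj_on h M" "\<F>' = h ` M"
        using \<F>'(1) subset_image_inj by metis
      have "finite M" "card M \<le> m" "M \<subseteq> sphere 0 1"
        using M N(1,2) \<F>'(2) finite_subset by (auto simp: card_image)
      moreover obtain e :: 'a where "e \<in> sphere 0 1"
        using nonempty_Basis norm_Basis by (metis ex_in_conv mem_sphere_0)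
      ultimately obtain u where u: "M \<subseteq> u ` {..<m}" "\<And>i. u i \<in> sphere 0 1"
        using finite_subset_tuple by metis
      obtain x y where xy: "x \<in> circumscribed K (u ` {..<m})" "y \<in> circumscribed K (u ` {..<m})"
        "s < dist x y"
        using gap[of u] u(2) by (auto simp: s_def)
      \<comment> \<open>The tuple \<open>u\<close> covers \<open>M\<close>, so its circumscribed set
        satisfies all the constraints from \<open>M\<close>.\<close>
      have "x /\<^sub>R s \<in> \<Inter>\<F>'" "y /\<^sub>R s \<in> \<Inter>\<F>'"
        using xy u(1) s unfolding M(3) h by (auto simp: circumscribed_def)
      moreover have "dist (x /\<^sub>R s) (y /\<^sub>R s) = dist x y / s"
        using s by (simp add: dist_norm divide_inverse_commute flip: scaleR_diff_right)
      then have "1 \<le> dist (x /\<^sub>R s) (y /\<^sub>R s)"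
        using xy(3) s by simp
      ultimately show ?thesis
        using ediam_ge[of "x /\<^sub>R s" "\<Inter>\<F>'" "y /\<^sub>R s" 1] by (simp del: Inter_iff)
    qed
    have "dist x y \<le> diameter K / ((1 - \<delta>) * s)" if "x \<in> \<Inter>(h ` N)" "y \<in> \<Inter>(h ` N)" for x y
    proof -
      have "(1 - \<delta>) * dist (s *\<^sub>R x) (s *\<^sub>R y) \<le> diameter K"
        using that int unfolding h by (intro dist_circumscribed_le[OF K(1) _ N(2-4)]) auto
      moreover have "dist (s *\<^sub>R x) (s *\<^sub>R y) = s * dist x y"
        using s by (simp add: dist_norm flip: scaleR_diff_right)
      ultimately show ?thesis
        using s \<delta>(3) by (simp add: pos_le_divide_eq ac_simps)
    qed
    then have "ediam (\<Inter>(h ` N)) \<le> ennreal (diameter K / ((1 - \<delta>) * s))"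
      using s \<delta>(3) diameter_ge_0[OF K(1)] by (subst ediam_le_iff) auto
    also have "\<dots> < ennreal (inverse (1 + \<epsilon>))"
    proof (rule ennreal_lessI)
      show "diameter K / ((1 - \<delta>) * s) < inverse (1 + \<epsilon>)"
        unfolding \<delta>(2) using \<eta> c(1) assms(1) by (simp add: c_def field_simps)
    qed (use assms(1) in simp)
    finally show "ediam (\<Inter>(h ` N)) < ennreal (inverse (1 + \<epsilon>))" .
  qed
qed

theorem theorem3p5:
  fixes \<epsilon> :: real
  assumes "\<epsilon> > 0"
  shows "(\<forall>\<F> :: (real ^ 'n::finite) set set.
            finite \<F> \<and> (\<forall>C\<in>\<F>. convex C) \<and>
            (\<forall>\<F>' \<subseteq> \<F>. card \<F>' \<le> n_diam TYPE('n) \<epsilon> * CARD('n) \<longrightarrow> ediam (\<Inter>\<F>') \<ge> 1)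
            \<longrightarrow> ediam (\<Inter>\<F>) \<ge> ennreal (inverse (1 + \<epsilon>)))
       \<and> (\<exists>\<F> :: (real ^ 'n) set set.
            finite \<F> \<and> (\<forall>C\<in>\<F>. convex C) \<and>
            (\<forall>\<F>' \<subseteq> \<F>. card \<F>' \<le> n_diam TYPE('n) \<epsilon> - 1 \<longrightarrow> ediam (\<Inter>\<F>') \<ge> 1) \<and>
            ediam (\<Inter>\<F>) < ennreal (inverse (1 + \<epsilon>)))"
proof -
  have n: "n_diam TYPE('n) \<epsilon> = (LEAST n. diam_approx TYPE(real ^ 'n) \<epsilon> n)"
    by (simp add: n_diam_def diam_approx_def)
  have approx: "diam_approx TYPE(real ^ 'n) \<epsilon> (n_diam TYPE('n) \<epsilon>)"
    unfolding n using ex_diam_approx[OF assms] by (rule LeastI_ex)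
  \<comment> \<open>Subtraction truncates at 0, so positivity of \<open>n_diam\<close> is needed
    before minimality applies.\<close>
  have "n_diam TYPE('n) \<epsilon> - 1 < n_diam TYPE('n) \<epsilon>"
    using two_le_if_diam_approx[OF approx] by simp
  then have "\<not> diam_approx TYPE(real ^ 'n) \<epsilon> (n_diam TYPE('n) \<epsilon> - 1)"
    unfolding n by (rule not_less_Least)
  then obtain \<F> :: "(real ^ 'n) set set" where \<F>: "finite \<F>" "\<And>C. C \<in> \<F> \<Longrightarrow> convex C"
    "\<And>\<F>'. \<F>' \<subseteq> \<F> \<Longrightarrow> card \<F>' \<le> n_diam TYPE('n) \<epsilon> - 1 \<Longrightarrow> 1 \<le> ediam (\<Inter>\<F>')"
    "ediam (\<Inter>\<F>) < ennreal (inverse (1 + \<epsilon>))"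
    using not_diam_approx_family[OF assms] by metis
  show ?thesis
  proof (intro conjI allI impI, elim conjE)
    fix \<G> :: "(real ^ 'n) set set"
    assume "finite \<G>" "\<forall>C\<in>\<G>. convex C"
      "\<forall>\<F>'\<subseteq>\<G>. card \<F>' \<le> n_diam TYPE('n) \<epsilon> * CARD('n) \<longrightarrow> 1 \<le> ediam (\<Inter>\<F>')"
    then show "ennreal (inverse (1 + \<epsilon>)) \<le> ediam (\<Inter>\<G>)"
      by (intro diameter_Helly[OF assms approx]) simp_all
  next
    show "\<exists>\<F> :: (real ^ 'n) set set. finite \<F> \<and> (\<forall>C\<in>\<F>. convex C) \<and>
        (\<forall>\<F>'\<subseteq>\<F>. card \<F>' \<le> n_diam TYPE('n) \<epsilon> - 1 \<longrightarrow> 1 \<le> ediam (\<Inter>\<F>')) \<and>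
        ediam (\<Inter>\<F>) < ennreal (inverse (1 + \<epsilon>))"
      using \<F> by (intro exI[of _ \<F>] conjI ballI allI impI)
  qed
qed

end
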